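(* Let $\alpha,\beta\in(0,1]$, let $\gamma,\delta,\eta,\zeta\ge 0$, and assume $d:=\eta\delta+\gamma\zeta+\gamma\eta/\alpha>0$. The Green's function corresponding to the homogeneous problem $$-D^{\beta}D^{\alpha}x(t)=0$$ with boundary conditions $$\gamma x(0)-\delta D^{\alpha}x(0)=0=\eta x(1)+\zeta D^{\alpha}x(1)$$ is $$G(t,s)=\begin{cases}\frac1d\left[\delta+\frac{\gamma}{\alpha}t^{\alpha}\right]\left[\zeta+\frac{\eta}{\alpha}(1-s^{\alpha})\right] & : t\le s,\\ \frac1d\left[\delta+\frac{\gamma}{\alpha}s^{\alpha}\right]\left[\zeta+\frac{\eta}{\alpha}(1-t^{\alpha})\right] & : s\le t,\end{cases}\qquad t,s\in[0,1].$$ That is, for every continuous function $h$ on $[0,1]$, the function $x(t)=\int_0^1 G(t,s)h(s)s^{\beta-1}\,ds$ is a solution of $-D^{\beta}D^{\alpha}x(t)=h(t)$ on $[0,1]$ satisfying these boundary conditions.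
   Context: For $\alpha\in(0,1]$ the conformable fractional derivative of order $\alpha$ of a function $f$ is $D^{\alpha}f(t):=\lim_{\varepsilon\to0}\frac{f(te^{\varepsilon t^{-\alpha}})-f(t)}{\varepsilon}$ for $t>0$, and $D^{\alpha}f(0):=\lim_{t\to0^+}D^{\alpha}f(t)$; if $f$ is differentiable at $t>0$ then $D^{\alpha}f(t)=t^{1-\alpha}f'(t)$. For functions on $[0,1]$ the derivative at $t=1$ is one-sided. $D^{\beta}D^{\alpha}x$ means $D^{\beta}(D^{\alpha}x)$. The term "Green's function" is meant in the sense spelled out in the claim (kernel of the solution operator with respect to the weight $s^{\beta-1}\,ds$). *)

theory Defs
  imports "HOL-Analysis.Analysis"
begin

text \<open>
  Functions on \<open>[0,1]\<close> are modelled by total functions \<open>real \<Rightarrow> real\<close> of which only the values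
  on \<open>[0,1]\<close> matter. Accordingly the increments are restricted to those that keep the argument
  in \<open>[0,1]\<close>: this is no restriction near \<open>0\<close> if \<open>0 < t < 1\<close>, and gives the one-sided
  derivative (increments \<open>\<epsilon> < 0\<close>) at \<open>t = 1\<close>.
\<close>

definition conf_increments :: "real \<Rightarrow> real \<Rightarrow> real set" where
  "conf_increments \<alpha> t = {\<epsilon>. t * exp (\<epsilon> * t powr (-\<alpha>)) \<in> {0..1}}"

definition conf_quotient :: "real \<Rightarrow> (real \<Rightarrow> real) \<Rightarrow> real \<Rightarrow> real \<Rightarrow> real" where
  "conf_quotient \<alpha> f t \<epsilon> = (f (t * exp (\<epsilon> * t powr (-\<alpha>))) - f t) / \<epsilon>"

definition has_conf_deriv_pos :: "real \<Rightarrow> (real \<Rightarrow> real) \<Rightarrow> real \<Rightarrow> real \<Rightarrow> bool" where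
  "has_conf_deriv_pos \<alpha> f t D \<longleftrightarrow>
     (conf_quotient \<alpha> f t \<longlongrightarrow> D) (at 0 within conf_increments \<alpha> t)"

definition conf_deriv_pos :: "real \<Rightarrow> (real \<Rightarrow> real) \<Rightarrow> real \<Rightarrow> real" where
  "conf_deriv_pos \<alpha> f t = Lim (at 0 within conf_increments \<alpha> t) (conf_quotient \<alpha> f t)"

text \<open>
  The conformable derivative \<open>D\<^sup>\<alpha> f (t)\<close> for \<open>t \<in> [0,1]\<close>. Its value is meaningful only where
  \<open>conf_differentiable \<alpha> f t\<close> holds, that is, where the defining limit exists.
\<close>

definition conf_deriv :: "real \<Rightarrow> (real \<Rightarrow> real) \<Rightarrow> real \<Rightarrow> real" where
  "conf_deriv \<alpha> f t =
     (if t > 0 then conf_deriv_pos \<alpha> f t else Lim (at_right 0) (conf_deriv_pos \<alpha> f))"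

definition conf_differentiable :: "real \<Rightarrow> (real \<Rightarrow> real) \<Rightarrow> real \<Rightarrow> bool" where
  "conf_differentiable \<alpha> f t \<longleftrightarrow>
     (if t > 0 then \<exists>D. has_conf_deriv_pos \<alpha> f t D
      else (\<forall>\<^sub>F s in at_right 0. \<exists>D. has_conf_deriv_pos \<alpha> f s D) \<and>
           (\<exists>D. (conf_deriv_pos \<alpha> f \<longlongrightarrow> D) (at_right 0)))"

text \<open>
  \<open>x\<close> solves \<open>-D\<^sup>\<beta> D\<^sup>\<alpha> x = h\<close> on \<open>[0,1]\<close> with the boundary conditions
  \<open>\<gamma> x(0) - \<delta> D\<^sup>\<alpha> x(0) = 0 = \<eta> x(1) + \<zeta> D\<^sup>\<alpha> x(1)\<close>; existence of all derivatives involved,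
  the end points included, is part of being a solution.
\<close>

definition conf_bvp_solution ::
  "real \<Rightarrow> real \<Rightarrow> real \<Rightarrow> real \<Rightarrow> real \<Rightarrow> real \<Rightarrow> (real \<Rightarrow> real) \<Rightarrow> (real \<Rightarrow> real) \<Rightarrow> bool" where
  "conf_bvp_solution \<alpha> \<beta> \<gamma> \<delta> \<eta> \<zeta> h x \<longleftrightarrow>
     (\<forall>t\<in>{0..1}. conf_differentiable \<alpha> x t) \<and>
     (\<forall>t\<in>{0..1}. conf_differentiable \<beta> (conf_deriv \<alpha> x) t) \<and>
     (\<forall>t\<in>{0..1}. - conf_deriv \<beta> (conf_deriv \<alpha> x) t = h t) \<and>
     \<gamma> * x 0 - \<delta> * conf_deriv \<alpha> x 0 = 0 \<and>
     \<eta> * x 1 + \<zeta> * conf_deriv \<alpha> x 1 = 0"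

text \<open>
  The kernel is integrated against the weight \<open>s\<^bsup>\<beta>-1\<^esup> ds\<close>. Integrability is required because
  the Lebesgue integral of a non-integrable function is \<open>0\<close> by convention. The value
  \<open>0 powr (\<beta> - 1) = 0\<close> concerns a null set only.
\<close>

definition is_green_function ::
  "real \<Rightarrow> real \<Rightarrow> real \<Rightarrow> real \<Rightarrow> real \<Rightarrow> real \<Rightarrow> (real \<Rightarrow> real \<Rightarrow> real) \<Rightarrow> bool" where
  "is_green_function \<alpha> \<beta> \<gamma> \<delta> \<eta> \<zeta> G \<longleftrightarrow>
     (\<forall>h. continuous_on {0..1} h \<longrightarrow>
        (\<forall>t\<in>{0..1}. set_integrable lborel {0..1} (\<lambda>s. G t s * h s * s powr (\<beta> - 1))) \<and>
        conf_bvp_solution \<alpha> \<beta> \<gamma> \<delta> \<eta> \<zeta> h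
          (\<lambda>t. LINT s:{0..1}|lborel. G t s * h s * s powr (\<beta> - 1)))"

lemma has_conf_deriv_pos_of_field_derivative:
  assumes f: "(f has_field_derivative f') (at t within {0..1})" and t: "0 < t" "t \<le> 1"
  shows "has_conf_deriv_pos \<alpha> f t (t powr (1 - \<alpha>) * f')"
proof -
  let ?g = "\<lambda>\<epsilon>. t * exp (\<epsilon> * t powr (-\<alpha>))"
  have "(?g has_field_derivative t * t powr (-\<alpha>)) (at 0 within conf_increments \<alpha> t)"
    by (auto intro!: derivative_eq_intros)
  moreover have "(f has_field_derivative f') (at (?g 0) within ?g ` conf_increments \<alpha> t)"
    using f by (auto intro: DERIV_subset simp: conf_increments_def)
  ultimately have "((f \<circ> ?g) has_field_derivative f' * (t * t powr (-\<alpha>)))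
      (at 0 within conf_increments \<alpha> t)"
    by (rule DERIV_image_chain[rotated])
  moreover have "t * t powr (-\<alpha>) = t powr (1 - \<alpha>)"
    using t by (simp add: powr_diff powr_minus field_simps)
  ultimately show ?thesis
    unfolding has_conf_deriv_pos_def conf_quotient_def
    by (simp add: has_field_derivative_iff o_def mult.commute)
qed

end

theory Submission
  imports Defs
begin

text \<open>
  Put \<open>p t = \<delta> + \<gamma>/\<alpha> t\<^sup>\<alpha>\<close> and \<open>q t = \<zeta> + \<eta>/\<alpha> (1 - t\<^sup>\<alpha>)\<close>. Both solve the homogeneous equation,
  \<open>p\<close> satisfies the boundary condition at \<open>0\<close> and \<open>q\<close> the one at \<open>1\<close>, and
  \<open>G t s = p (min t s) q (max t s) / d\<close>. Let \<open>A t\<close> be the integral of \<open>p h\<close> over \<open>[0,t]\<close> and \<open>B t\<close>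
  that of \<open>q h\<close> over \<open>[t,1]\<close>, both with the weight \<open>s\<^bsup>\<beta>-1\<^esup>\<close>. Then the candidate solution is
  \<open>x = (q A + p B)/d\<close> (\<open>integral_glued_kernel\<close>).

  The rest is variation of parameters. In \<open>D\<^sup>\<alpha> x\<close> the two terms in which \<open>A\<close> and \<open>B\<close> are
  differentiated cancel, and since \<open>D\<^sup>\<alpha> p = \<gamma>\<close> and \<open>D\<^sup>\<alpha> q = -\<eta>\<close> are constant,
  \<open>D\<^sup>\<alpha> x = (\<gamma> B - \<eta> A)/d\<close>. Away from \<open>0\<close>, \<open>D\<^sup>\<beta>\<close> is the ordinary derivative times \<open>t\<^bsup>1-\<beta>\<^esup>\<close>, the
  reciprocal of the weight that differentiating \<open>A\<close> and \<open>B\<close> produces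
  (\<open>weighted_primitive_has_field_derivative\<close>). Hence \<open>D\<^sup>\<beta> D\<^sup>\<alpha> x = -(\<gamma> q + \<eta> p) h / d = -h\<close>, because
  \<open>\<gamma> q + \<eta> p\<close> is the constant \<open>d\<close>. At each end point one of \<open>A\<close>, \<open>B\<close> vanishes, and the boundary
  conditions of \<open>x\<close> reduce to those of \<open>p\<close> and \<open>q\<close>.

  The singularity of the weights at \<open>0\<close> is harmless: the derivatives at \<open>0\<close> are defined as limits, and
  both \<open>D\<^sup>\<alpha> x\<close> and \<open>h\<close> are continuous on all of \<open>[0,1]\<close> (\<open>conf_deriv_eqI\<close>).
\<close>

section \<open>Conformable derivatives on the unit interval\<close>

text \<open>All \<open>\<epsilon> \<le> 0\<close> are admissible increments, so limits along the increments are unique.\<close>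

lemma conf_increments_at_0_nontrivial:
  assumes "0 < t" "t \<le> 1"
  shows "at 0 within conf_increments \<alpha> t \<noteq> bot"
proof -
  have "{..<0} \<subseteq> conf_increments \<alpha> t"
  proof
    fix \<epsilon> :: real
    assume "\<epsilon> \<in> {..<0}"
    then have "exp (\<epsilon> * t powr (-\<alpha>)) \<le> 1"
      by (simp add: mult_nonpos_nonneg)
    with assms have "t * exp (\<epsilon> * t powr (-\<alpha>)) \<le> 1"
      by (simp add: mult_le_one)
    with assms show "\<epsilon> \<in> conf_increments \<alpha> t"
      by (simp add: conf_increments_def)
  qed
  then have "at_left 0 \<le> at 0 within conf_increments \<alpha> t"
    by (rule at_le)
  then show ?thesis
    using trivial_limit_at_left_real[of "0::real"] bot.extremum_uniqueI by force
qed

lemma has_conf_deriv_pos_imp_conf_deriv_pos: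
  assumes "has_conf_deriv_pos \<alpha> f t D" "0 < t" "t \<le> 1"
  shows "conf_deriv_pos \<alpha> f t = D"
  using assms conf_increments_at_0_nontrivial
  unfolding has_conf_deriv_pos_def conf_deriv_pos_def by (blast intro: tendsto_Lim)

lemma has_conf_deriv_pos_cong:
  assumes "\<And>s. s \<in> {0..1} \<Longrightarrow> f s = g s" and "t \<in> {0..1}"
  shows "has_conf_deriv_pos \<alpha> f t D \<longleftrightarrow> has_conf_deriv_pos \<alpha> g t D"
  unfolding has_conf_deriv_pos_def
proof (rule Lim_cong_within)
  fix \<epsilon> :: real
  assume "\<epsilon> \<in> conf_increments \<alpha> t"
  with assms show "conf_quotient \<alpha> f t \<epsilon> = conf_quotient \<alpha> g t \<epsilon>"
    by (simp add: conf_quotient_def conf_increments_def)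
qed simp_all

text \<open>
  The derivative at \<open>0\<close> is the limit of the derivatives at positive arguments. Hence a function that is
  continuous on \<open>[0,1]\<close> and represents the derivative on \<open>(0,1]\<close> also does so at \<open>0\<close>.
\<close>

lemma conf_deriv_eqI:
  assumes deriv: "\<And>t. 0 < t \<Longrightarrow> t \<le> 1 \<Longrightarrow> has_conf_deriv_pos \<alpha> f t (g t)"
    and cont: "continuous_on {0..1} g"
    and t: "t \<in> {0..1}"
  shows "conf_differentiable \<alpha> f t" and "conf_deriv \<alpha> f t = g t"
proof -
  have near: "\<forall>\<^sub>F s in at_right 0. (0::real) < s \<and> s \<le> 1"
    by (auto simp: eventually_at_right_field intro!: exI[of _ 1])
  have "(g \<longlongrightarrow> g 0) (at_right 0)"
    using cont by (simp add: continuous_on_Icc_at_rightD)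
  then have lim: "(conf_deriv_pos \<alpha> f \<longlongrightarrow> g 0) (at_right 0)"
  proof (rule Lim_transform_eventually)
    show "\<forall>\<^sub>F s in at_right 0. g s = conf_deriv_pos \<alpha> f s"
      using near by eventually_elim
        (simp add: has_conf_deriv_pos_imp_conf_deriv_pos[OF deriv])
  qed
  have "\<forall>\<^sub>F s in at_right 0. \<exists>D. has_conf_deriv_pos \<alpha> f s D"
    using near by eventually_elim (use deriv in blast)
  with lim deriv t show "conf_differentiable \<alpha> f t"
    by (auto simp: conf_differentiable_def)
  have "Lim (at_right 0) (conf_deriv_pos \<alpha> f) = g 0"
    using lim by (intro tendsto_Lim) simp_all
  with t show "conf_deriv \<alpha> f t = g t"
    by (cases "t = 0")
      (auto simp: conf_deriv_def has_conf_deriv_pos_imp_conf_deriv_pos[OF deriv])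
qed

section \<open>Integration against a power weight\<close>

lemma set_integrable_powr_weight:
  fixes g :: "real \<Rightarrow> real"
  assumes g: "continuous_on {0..1} g" and \<beta>: "0 < \<beta>"
  shows "set_integrable lborel {0..1} (\<lambda>s. g s * s powr (\<beta> - 1))"
proof -
  have "(\<lambda>s. s powr (\<beta> - 1)) absolutely_integrable_on {0..1}"
    using \<beta> by (intro nonnegative_absolutely_integrable_1 integrable_on_powr_from_0) auto
  then have weight: "set_integrable lborel {0..1} (\<lambda>s. s powr (\<beta> - 1))"
    unfolding set_integrable_def by (subst (asm) integrable_completion) simp_all
  have "bounded (g ` {0..1})"
    by (intro compact_imp_bounded compact_continuous_image g) simp
  then obtain C where C: "\<forall>s\<in>{0..1}. \<bar>g s\<bar> \<le> C"
    by (auto simp: bounded_iff)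
  have [measurable]: "(\<lambda>s. indicat_real {0..1} s *\<^sub>R g s) \<in> borel_measurable borel"
    by (rule borel_measurable_continuous_on_indicator[OF _ g]) simp
  have "set_integrable lborel {0..1} (\<lambda>s. C * s powr (\<beta> - 1))"
    using weight by simp
  then show ?thesis
    unfolding set_integrable_def
  proof (rule Bochner_Integration.integrable_bound)
    have "(\<lambda>s. (indicat_real {0..1} s *\<^sub>R g s) * s powr (\<beta> - 1)) \<in> borel_measurable lborel"
      by measurable
    then show "(\<lambda>s. indicat_real {0..1} s *\<^sub>R (g s * s powr (\<beta> - 1))) \<in> borel_measurable lborel"
      by (simp add: mult.assoc)
    show "AE s in lborel. norm (indicat_real {0..1} s *\<^sub>R (g s * s powr (\<beta> - 1)))
        \<le> norm (indicat_real {0..1} s *\<^sub>R (C * s powr (\<beta> - 1)))"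
    proof (intro AE_I2)
      fix s :: real
      have "\<bar>g s\<bar> \<le> \<bar>C\<bar>" if "s \<in> {0..1}"
        using C that by force
      then show "norm (indicat_real {0..1} s *\<^sub>R (g s * s powr (\<beta> - 1)))
          \<le> norm (indicat_real {0..1} s *\<^sub>R (C * s powr (\<beta> - 1)))"
        by (auto simp: indicator_def abs_mult intro!: mult_right_mono)
    qed
  qed
qed

lemma integrable_on_powr_weight:
  fixes g :: "real \<Rightarrow> real"
  assumes "continuous_on {0..1} g" and "0 < \<beta>"
  shows "(\<lambda>s. g s * s powr (\<beta> - 1)) integrable_on {0..1}"
  using set_borel_integral_eq_integral(1)[OF set_integrable_powr_weight[OF assms]] .

definition weighted_primitive :: "real \<Rightarrow> (real \<Rightarrow> real) \<Rightarrow> real \<Rightarrow> real" where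
  "weighted_primitive \<beta> g t = integral {0..t} (\<lambda>s. g s * s powr (\<beta> - 1))"

lemma weighted_primitive_0 [simp]: "weighted_primitive \<beta> g 0 = 0"
  by (simp add: weighted_primitive_def)

lemma continuous_on_weighted_primitive:
  assumes "continuous_on {0..1} g" and "0 < \<beta>"
  shows "continuous_on {0..1} (weighted_primitive \<beta> g)"
  unfolding weighted_primitive_def
  by (rule indefinite_integral_continuous_1[OF integrable_on_powr_weight[OF assms]])

lemma weighted_primitive_has_field_derivative:
  assumes g: "continuous_on {0..1} g" and \<beta>: "0 < \<beta>" and t: "0 < t" "t \<le> 1"
  shows "(weighted_primitive \<beta> g has_field_derivative g t * t powr (\<beta> - 1)) (at t within {0..1})"
proof -
  have "continuous (at t within {0..1}) g"
    using g t by (simp add: continuous_on_eq_continuous_within)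
  then have "continuous (at t within {0..1}) (\<lambda>s. g s * s powr (\<beta> - 1))"
    using t by (intro continuous_intros) auto
  with t show ?thesis
    unfolding weighted_primitive_def has_real_derivative_iff_has_vector_derivative
    using integral_has_vector_derivative_continuous_at
      [OF integrable_on_powr_weight[OF g \<beta>], of t "{}"] by simp
qed

text \<open>
  A kernel of the form \<open>u (min t s) v (max t s)\<close> is how two homogeneous solutions are glued along the
  diagonal; splitting the integral at \<open>s = t\<close> separates the variables.
\<close>

lemma integral_glued_kernel:
  fixes u v h :: "real \<Rightarrow> real"
  assumes u: "continuous_on {0..1} u" and v: "continuous_on {0..1} v"
    and h: "continuous_on {0..1} h" and \<beta>: "0 < \<beta>" and t: "t \<in> {0..1}"
  shows "set_integrable lborel {0..1} (\<lambda>s. u (min t s) * v (max t s) * h s * s powr (\<beta> - 1))"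
    (is ?integrable)
    and "(LINT s:{0..1}|lborel. u (min t s) * v (max t s) * h s * s powr (\<beta> - 1)) =
      v t * weighted_primitive \<beta> (\<lambda>s. u s * h s) t +
      u t * (weighted_primitive \<beta> (\<lambda>s. v s * h s) 1 - weighted_primitive \<beta> (\<lambda>s. v s * h s) t)"
    (is ?split)
proof -
  let ?w = "\<lambda>s. s powr (\<beta> - 1)" and ?k = "\<lambda>s. u (min t s) * v (max t s) * h s"
  have "continuous_on {0..1} (\<lambda>s. u (min t s))" "continuous_on {0..1} (\<lambda>s. v (max t s))"
    using t by (auto intro!: continuous_on_compose2[OF u] continuous_on_compose2[OF v]
        continuous_intros)
  then have k: "continuous_on {0..1} ?k"
    by (intro continuous_intros h)
  show int: ?integrable
    by (rule set_integrable_powr_weight[OF k \<beta>])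
  have vh: "continuous_on {0..1} (\<lambda>s. v s * h s)"
    by (intro continuous_intros v h)
  have "(LINT s:{0..1}|lborel. ?k s * ?w s) = integral {0..1} (\<lambda>s. ?k s * ?w s)"
    by (rule set_borel_integral_eq_integral(2)[OF int])
  also have "\<dots> = integral {0..t} (\<lambda>s. ?k s * ?w s) + integral {t..1} (\<lambda>s. ?k s * ?w s)"
    using t integrable_on_powr_weight[OF k \<beta>]
    by (simp add: Henstock_Kurzweil_Integration.integral_combine)
  also have "integral {0..t} (\<lambda>s. ?k s * ?w s) = integral {0..t} (\<lambda>s. v t * (u s * h s * ?w s))"
    by (intro Henstock_Kurzweil_Integration.integral_cong) (auto simp: min_def max_def)
  also have "\<dots> = v t * weighted_primitive \<beta> (\<lambda>s. u s * h s) t"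
    by (simp add: weighted_primitive_def)
  also have "integral {t..1} (\<lambda>s. ?k s * ?w s) = integral {t..1} (\<lambda>s. u t * (v s * h s * ?w s))"
    by (intro Henstock_Kurzweil_Integration.integral_cong) (auto simp: min_def max_def)
  also have "\<dots> = u t * integral {t..1} (\<lambda>s. v s * h s * ?w s)"
    by simp
  also have "integral {t..1} (\<lambda>s. v s * h s * ?w s) =
      weighted_primitive \<beta> (\<lambda>s. v s * h s) 1 - weighted_primitive \<beta> (\<lambda>s. v s * h s) t"
    using t Henstock_Kurzweil_Integration.integral_combine
      [OF _ _ integrable_on_powr_weight[OF vh \<beta>], of t]
    by (simp add: weighted_primitive_def)
  finally show ?split .
qed

section \<open>The Green's function\<close>

theorem theorem2p1:
  fixes \<alpha> \<beta> \<gamma> \<delta> \<eta> \<zeta> d :: real and G :: "real \<Rightarrow> real \<Rightarrow> real"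
  assumes "0 < \<alpha>" and "\<alpha> \<le> 1" and "0 < \<beta>" and "\<beta> \<le> 1"
    and "0 \<le> \<gamma>" and "0 \<le> \<delta>" and "0 \<le> \<eta>" and "0 \<le> \<zeta>"
    and "d = \<eta> * \<delta> + \<gamma> * \<zeta> + \<gamma> * \<eta> / \<alpha>" and "d > 0"
    and "\<And>t s. t \<in> {0..1} \<Longrightarrow> s \<in> {0..1} \<Longrightarrow> t \<le> s \<Longrightarrow>
           G t s = 1 / d * (\<delta> + \<gamma> / \<alpha> * t powr \<alpha>) * (\<zeta> + \<eta> / \<alpha> * (1 - s powr \<alpha>))"
    and "\<And>t s. t \<in> {0..1} \<Longrightarrow> s \<in> {0..1} \<Longrightarrow> s \<le> t \<Longrightarrow>
           G t s = 1 / d * (\<delta> + \<gamma> / \<alpha> * s powr \<alpha>) * (\<zeta> + \<eta> / \<alpha> * (1 - t powr \<alpha>))"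
  shows "is_green_function \<alpha> \<beta> \<gamma> \<delta> \<eta> \<zeta> G"
  unfolding is_green_function_def
proof (intro allI impI)
  fix h :: "real \<Rightarrow> real"
  assume h: "continuous_on {0..1} h"
  define p where "p t = \<delta> + \<gamma> / \<alpha> * t powr \<alpha>" for t
  \<comment> \<open>The factor \<open>1/d\<close> is absorbed into the second homogeneous solution.\<close>
  define q where "q t = (\<zeta> + \<eta> / \<alpha> * (1 - t powr \<alpha>)) / d" for t
  let ?x = "\<lambda>t. LINT s:{0..1}|lborel. G t s * h s * s powr (\<beta> - 1)"
  let ?A = "weighted_primitive \<beta> (\<lambda>s. p s * h s)"
  let ?Q = "weighted_primitive \<beta> (\<lambda>s. q s * h s)"
  define x where "x t = q t * ?A t + p t * (?Q 1 - ?Q t)" for t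
  define y where "y t = \<gamma> * (?Q 1 - ?Q t) - \<eta> / d * ?A t" for t

  have G: "G t s = p (min t s) * q (max t s)" if "t \<in> {0..1}" "s \<in> {0..1}" for t s
    using assms(11,12)[OF that] by (cases "t \<le> s") (simp_all add: p_def q_def)
  have "continuous_on {0..1} (\<lambda>t. t powr \<alpha>)"
    using \<open>0 < \<alpha>\<close> by (intro continuous_on_powr' continuous_intros) auto
  then have p: "continuous_on {0..1} p" and q: "continuous_on {0..1} q"
    unfolding p_def q_def using \<open>0 < \<alpha>\<close> \<open>d > 0\<close> by (auto intro!: continuous_intros)
  have ph: "continuous_on {0..1} (\<lambda>s. p s * h s)" and qh: "continuous_on {0..1} (\<lambda>s. q s * h s)"
    by (intro continuous_intros p q h)+
  have d: "\<gamma> * q t + \<eta> / d * p t = 1" for t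
  proof -
    have "\<gamma> * q t + \<eta> / d * p t = (\<eta> * \<delta> + \<gamma> * \<zeta> + \<gamma> * \<eta> / \<alpha>) / d"
      using \<open>d > 0\<close> \<open>0 < \<alpha>\<close> by (simp add: p_def q_def field_simps)
    with assms(9) \<open>d > 0\<close> show ?thesis by simp
  qed

  have integrable: "set_integrable lborel {0..1} (\<lambda>s. G t s * h s * s powr (\<beta> - 1))"
    if "t \<in> {0..1}" for t
    using integral_glued_kernel(1)[OF p q h \<open>0 < \<beta>\<close> that]
    by (subst set_integrable_cong[OF refl]) (simp_all add: G[OF that])
  have x: "?x t = x t" if "t \<in> {0..1}" for t
  proof -
    have "?x t = (LINT s:{0..1}|lborel. p (min t s) * q (max t s) * h s * s powr (\<beta> - 1))"
      by (rule set_lebesgue_integral_cong) (simp_all add: G[OF that])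
    also have "\<dots> = x t"
      unfolding x_def by (rule integral_glued_kernel(2)[OF p q h \<open>0 < \<beta>\<close> that])
    finally show ?thesis .
  qed

  have x_deriv: "has_conf_deriv_pos \<alpha> ?x t (y t)" if t: "0 < t" "t \<le> 1" for t
  proof -
    have p': "(p has_field_derivative \<gamma> * t powr (\<alpha> - 1)) (at t within {0..1})"
      and q': "(q has_field_derivative - \<eta> / d * t powr (\<alpha> - 1)) (at t within {0..1})"
      unfolding p_def q_def using t \<open>0 < \<alpha>\<close> \<open>d > 0\<close>
      by (auto intro!: derivative_eq_intros simp: field_simps)
    \<comment> \<open>The contributions of \<open>?A'\<close> and \<open>?Q'\<close> are \<open>q p h w\<close> and \<open>- p q h w\<close>, with \<open>w\<close> the weight.\<close>
    have "(x has_field_derivative y t * t powr (\<alpha> - 1)) (at t within {0..1})"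
      unfolding x_def
      by (rule derivative_eq_intros p' q' refl
          weighted_primitive_has_field_derivative ph qh \<open>0 < \<beta>\<close> t)+
        (simp add: y_def algebra_simps)
    from has_conf_deriv_pos_of_field_derivative[OF this t, of \<alpha>]
    have "has_conf_deriv_pos \<alpha> x t (t powr (1 - \<alpha>) * (y t * t powr (\<alpha> - 1)))" .
    also have "t powr (1 - \<alpha>) * (y t * t powr (\<alpha> - 1)) = y t"
      using t by (simp add: powr_add[symmetric])
    finally show ?thesis
      using t by (subst has_conf_deriv_pos_cong[OF x]) auto
  qed
  have y: "continuous_on {0..1} y"
    unfolding y_def
    by (intro continuous_intros continuous_on_weighted_primitive ph qh \<open>0 < \<beta>\<close>)
  note Dx = conf_deriv_eqI[OF x_deriv y]

  have y_deriv: "has_conf_deriv_pos \<beta> (conf_deriv \<alpha> ?x) t (- h t)" if t: "0 < t" "t \<le> 1" for t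
  proof -
    let ?w = "t powr (\<beta> - 1)"
    have "\<gamma> * (q t * h t * ?w) + \<eta> / d * (p t * h t * ?w) = (\<gamma> * q t + \<eta> / d * p t) * (h t * ?w)"
      by (simp only: algebra_simps)
    also have "\<dots> = h t * ?w"
      by (simp only: d mult_1)
    finally have w: "\<gamma> * (q t * h t * ?w) + \<eta> / d * (p t * h t * ?w) = h t * ?w" .
    have "(y has_field_derivative - h t * ?w) (at t within {0..1})"
      unfolding y_def
      by (rule derivative_eq_intros refl
          weighted_primitive_has_field_derivative ph qh \<open>0 < \<beta>\<close> t)+
        (use w in \<open>simp add: algebra_simps\<close>)
    from has_conf_deriv_pos_of_field_derivative[OF this t, of \<beta>]
    have "has_conf_deriv_pos \<beta> y t (t powr (1 - \<beta>) * (- h t * ?w))" .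
    also have "t powr (1 - \<beta>) * (- h t * ?w) = - h t"
      using t by (simp add: powr_add[symmetric])
    finally show ?thesis
      using t by (subst has_conf_deriv_pos_cong[OF Dx(2)]) auto
  qed
  have "continuous_on {0..1} (\<lambda>t. - h t)"
    by (intro continuous_intros h)
  note DDx = conf_deriv_eqI[OF y_deriv this]

  have "\<gamma> * ?x 0 - \<delta> * conf_deriv \<alpha> ?x 0 = 0"
    using \<open>0 < \<alpha>\<close> by (simp add: x Dx(2)) (simp add: x_def y_def p_def)
  moreover have "\<eta> * ?x 1 + \<zeta> * conf_deriv \<alpha> ?x 1 = 0"
    using \<open>0 < \<alpha>\<close> by (simp add: x Dx(2)) (simp add: x_def y_def q_def)
  ultimately have "conf_bvp_solution \<alpha> \<beta> \<gamma> \<delta> \<eta> \<zeta> h ?x"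
    unfolding conf_bvp_solution_def using Dx(1) DDx by simp
  with integrable show "(\<forall>t\<in>{0..1}. set_integrable lborel {0..1} (\<lambda>s. G t s * h s * s powr (\<beta> - 1))) \<and>
      conf_bvp_solution \<alpha> \<beta> \<gamma> \<delta> \<eta> \<zeta> h ?x"
    by blast
qed

end
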